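(* Let $q$ be an odd prime power, a power of the prime $p$, and let $$u_q(T)=T+\bigl(T(T^q-T)\bigr)^p\in\mathbf{F}_q[T].$$ Then $$\mathcal{S}_q(u_q)=\{1\}.$$ Equivalently, $u_q$ fixes $\mathbf{F}_q$ pointwise and is not injective on $\mathbf{F}_{q^m}$ for any $m>1$.
   Context: For a polynomial $f\in\mathbf{F}_q[T]$, its finite-extension permutation spectrum is $\mathcal{S}_q(f)=\{m\in\mathbf{N}_{>0}: f\colon\mathbf{F}_{q^m}\to\mathbf{F}_{q^m}\text{ is bijective}\}$. *)

theory Defs
  imports "HOL-Algebra.Algebraic_Closure_Type" "HOL-Library.Cardinality"
begin

text \<open>
  The ground field $\mathbf{F}_q$ is an arbitrary type \<open>'a\<close> of class \<open>finite_field\<close>, so that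
  \<open>q = CARD('a)\<close>. Its finite extensions are taken inside the algebraic closure
  \<open>'a alg_closure\<close>: for \<open>m > 0\<close>, \<open>ext_field m\<close> is the unique intermediate field with
  \<open>q ^ m\<close> elements (see \<open>ex1_ext_field\<close> below; for \<open>m = 0\<close> the value is unspecified).
\<close>

definition ext_field :: "nat \<Rightarrow> 'a :: finite_field alg_closure set" where
  "ext_field m = (THE K. subfield K ring_of_type_algebra \<and> range to_ac \<subseteq> K \<and> card K = CARD('a) ^ m)"

definition ext_perm_spectrum :: "'a :: finite_field poly \<Rightarrow> nat set" where
  "ext_perm_spectrum f = {m. m > 0 \<and> bij_betw (poly (map_poly to_ac f)) (ext_field m) (ext_field m)}"

definition u_poly :: "nat \<Rightarrow> nat \<Rightarrow> 'a :: comm_ring_1 poly" where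
  "u_poly p q = (let T = [:0, 1:] in T + (T * (T ^ q - T)) ^ p)"


subsection \<open>Existence and uniqueness of the extension of degree \<open>m\<close>\<close>

lemma subfield_type_iff:
  fixes K :: "'b :: field set"
  shows "subfield K ring_of_type_algebra \<longleftrightarrow>
     1 \<in> K \<and> (\<forall>x\<in>K. \<forall>y\<in>K. x - y \<in> K) \<and> (\<forall>x\<in>K. \<forall>y\<in>K. x * y \<in> K) \<and> (\<forall>x\<in>K. inverse x \<in> K)"
    (is "?L \<longleftrightarrow> ?R")
proof -
  let ?F = "ring_of_type_algebra :: 'b ring"
  interpret F: field ?F by (rule field_from_type_algebra)
  have simps: "carrier ?F = UNIV" "monoid.mult ?F = (*)" "monoid.one ?F = 1"
       "ring.zero ?F = 0" "ring.add ?F = (+)"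
    by (auto simp: ring_of_type_algebra_def)
  have minv: "m_inv ?F x = inverse x" if "x \<noteq> 0" for x
    by (rule F.inv_char) (use that in \<open>auto simp: simps\<close>)
  have ainv: "a_inv ?F x = - x" for x
    by (rule F.minus_equality) (auto simp: simps)
  show ?thesis
  proof
    assume L: ?L
    note subring = subfieldE(1)[OF L]
    have one: "1 \<in> K" and zero: "0 \<in> K"
      using subringE(2,3)[OF subring] by (auto simp: simps)
    have mult: "x * y \<in> K" if "x \<in> K" "y \<in> K" for x y
      using subringE(6)[OF subring that] by (auto simp: simps)
    have diff: "x - y \<in> K" if "x \<in> K" "y \<in> K" for x y
      using subringE(7)[OF subring that(1) subringE(5)[OF subring that(2)]]
      by (auto simp: simps ainv)
    have inv: "inverse x \<in> K" if "x \<in> K" for x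
    proof (cases "x = 0")
      case False
      with F.subfield_m_inv(1)[OF L, of x] that show ?thesis by (auto simp: simps minv)
    qed (use zero in auto)
    show ?R using one mult diff inv by blast
  next
    assume R: ?R
    have zero: "0 \<in> K" using R by (metis diff_self)
    have uminus: "-x \<in> K" if "x \<in> K" for x
      using R zero that by (metis diff_0)
    have add: "x + y \<in> K" if "x \<in> K" "y \<in> K" for x y
      using R uminus that by (metis diff_minus_eq_add)
    show ?L
    proof (rule F.subfieldI')
      show "subring K ?F"
        by (rule F.subringI) (use R add uminus in \<open>auto simp: simps ainv\<close>)
      show "m_inv ?F k \<in> K" if "k \<in> K - {\<zero>\<^bsub>?F\<^esub>}" for k
        using that R by (auto simp: simps minv)
    qed
  qed
qed

lemma subfield_power_card:
  fixes K :: "'b :: field set"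
  assumes K: "subfield K ring_of_type_algebra" "finite K" and x: "x \<in> K"
  shows "x ^ card K = x"
proof (cases "x = 0")
  case True
  thus ?thesis using K(2) x by (auto simp: card_gt_0_iff)
next
  case False
  note R = K(1)[unfolded subfield_type_iff]
  have zero: "0 \<in> K" using R by (metis diff_self)
  have "(\<Prod>y\<in>K-{0}. x * y) = x ^ (card K - 1) * \<Prod>(K-{0})"
    using zero K(2) by (simp add: prod.distrib)
  also have "(\<Prod>y\<in>K-{0}. x * y) = (\<Prod>y\<in>K-{0}. y)"
    by (rule prod.reindex_bij_witness[of _ "\<lambda>y. inverse x * y" "\<lambda>y. x * y"])
       (use False R x in auto)
  finally have "x ^ (card K - 1) = 1"
    using K(2) by (auto simp: prod_zero_iff)
  moreover have "card K = Suc (card K - 1)"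
    using K(2) x by (metis Suc_diff_1 card_gt_0_iff empty_iff)
  ultimately show ?thesis by (metis power_Suc mult_1_right)
qed

lemma power_card_add:
  fixes x y :: "'a :: finite_field alg_closure"
  shows "(x + y) ^ CARD('a) = x ^ CARD('a) + y ^ CARD('a)"
proof -
  let ?q = "CARD('a)"
  have q: "?q > 0" by (simp add: finite_UNIV_card_ge_0)
  define P :: "'a poly" where "P = [:1, 1:] ^ ?q - (monom 1 ?q + 1)"
  have "P = 0"
  proof (rule poly_eqI_degree_lead_coeff[where A = UNIV and n = ?q])
    have "coeff ([:1, 1:] ^ ?q :: 'a poly) ?q = lead_coeff ([:1, 1:] ^ ?q)"
      by (simp add: degree_power_eq)
    also have "\<dots> = 1" by (simp only: lead_coeff_power) simp
    finally show "coeff P ?q = coeff 0 ?q" using q by (auto simp: P_def)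
    show "degree P \<le> ?q"
      unfolding P_def
      by (intro degree_diff_le degree_add_le) (auto simp: degree_power_eq degree_monom_eq)
    show "poly P z = poly 0 z" for z
      by (simp add: P_def poly_monom finite_field_power_card_eq_same)
  qed auto
  hence *: "[:1, 1:] ^ ?q = (monom 1 ?q + 1 :: 'a poly)" by (simp add: P_def)
  have c: "of_nat (?q choose k) = (of_bool (k = ?q \<or> k = 0) :: 'a)" if "k \<le> ?q" for k
  proof -
    have "coeff ([:1, 1:] ^ ?q :: 'a poly) k = of_nat (?q choose k)"
      using coeff_linear_poly_power[of k ?q "1 :: 'a" 1] that by simp
    moreover have "coeff (monom 1 ?q + 1 :: 'a poly) k = of_bool (k = ?q \<or> k = 0)"
      using q by (auto simp: coeff_1)
    ultimately show ?thesis using * by simp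
  qed
  have c': "of_nat (?q choose k) = (of_bool (k = ?q \<or> k = 0) :: 'a alg_closure)" if "k \<le> ?q" for k
    using c[OF that] by (metis of_bool_def to_ac_0 to_ac_1 to_ac_of_nat)
  have "(x + y) ^ ?q = (\<Sum>k\<le>?q. of_nat (?q choose k) * x ^ k * y ^ (?q - k))"
    by (rule binomial_ring)
  also have "\<dots> = (\<Sum>k\<in>{0,?q}. of_nat (?q choose k) * x ^ k * y ^ (?q - k))"
    by (rule sum.mono_neutral_right) (auto simp: c')
  also have "\<dots> = x ^ ?q + y ^ ?q" using q by simp
  finally show ?thesis .
qed

lemma power_card_power_add:
  fixes x y :: "'a :: finite_field alg_closure"
  shows "(x + y) ^ (CARD('a) ^ m) = x ^ (CARD('a) ^ m) + y ^ (CARD('a) ^ m)"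
proof (induction m arbitrary: x y)
  case (Suc m)
  thus ?case by (simp only: power_Suc power_mult power_card_add)
qed simp

lemma card_fixed_points:
  assumes m: "m > 0"
  shows "card {x :: 'a :: finite_field alg_closure. x ^ (CARD('a) ^ m) = x} = CARD('a) ^ m"
proof -
  let ?Q = "CARD('a) ^ m"
  have "CARD('a) > 1"
    using card_mono[of UNIV "{0, 1 :: 'a}"] by simp
  hence Q: "?Q > 1" using m by (rule one_less_power)
  have "of_nat CARD('a) = (0 :: 'a)"
  proof -
    have "(\<Sum>x\<in>UNIV. x :: 'a) = (\<Sum>x\<in>UNIV. x + 1)"
      by (rule sum.reindex_bij_witness[of _ "\<lambda>x. x + 1" "\<lambda>x. x - 1"]) auto
    thus ?thesis by (simp add: sum.distrib)
  qed
  hence "of_nat CARD('a) = (0 :: 'a alg_closure)"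
    by (metis to_ac_0 to_ac_of_nat)
  hence Q0: "of_nat ?Q = (0 :: 'a alg_closure)" using m by simp
  define p :: "'a alg_closure poly" where "p = monom 1 ?Q - [:0, 1:]"
  have deg: "degree p = ?Q" unfolding p_def
    by (subst diff_conv_add_uminus, subst degree_add_eq_left) (use Q in \<open>auto simp: degree_monom_eq\<close>)
  hence nz: "p \<noteq> 0" using Q by auto
  have pd: "pderiv p = -1"
    unfolding p_def by (simp only: pderiv_diff pderiv_monom Q0) (simp add: pderiv_pCons one_pCons)
  have roots: "poly p x = 0 \<longleftrightarrow> x ^ ?Q = x" for x
    by (simp add: p_def poly_monom)
  obtain A where A: "size A = degree p" "p = smult (lead_coeff p) (\<Prod>x\<in>#A. [:-x, 1:])"
    using alg_closed_imp_factorization[OF nz] by blast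
  have setA: "set_mset A = {x. x ^ ?Q = x}"
  proof -
    have "poly p x = 0 \<longleftrightarrow> x \<in># A" for x
      using nz by (subst A(2)) (auto simp: poly_prod_mset prod_mset_zero_iff)
    thus ?thesis using roots by auto
  qed
  have "count A x = 1" if x: "x \<in># A" for x
  proof (rule ccontr)
    assume "count A x \<noteq> 1"
    moreover have "count A x \<noteq> 0" using x by simp
    ultimately have "count A x \<ge> 2" by linarith
    hence "{#x, x#} \<subseteq># A" by (auto simp: subseteq_mset_def)
    then obtain B where B: "A = {#x, x#} + B" by (auto simp: subset_mset.le_iff_add)
    define r where "r = smult (lead_coeff p) (\<Prod>x\<in>#B. [:-x, 1:])"
    have "p = [:-x, 1:] * ([:-x, 1:] * r)"
      by (subst A(2)) (simp add: B r_def)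
    hence "poly (pderiv p) x = poly (pderiv ([:-x, 1:] * ([:-x, 1:] * r))) x" by simp
    also have "\<dots> = 0" by (simp only: pderiv_mult poly_add poly_mult) simp
    finally show False by (simp add: pd)
  qed
  hence "size A = card (set_mset A)"
    by (simp add: size_multiset_overloaded_eq)
  thus ?thesis using A(1) deg setA by simp
qed

lemma ex1_ext_field:
  assumes "m > 0"
  shows "\<exists>!K :: 'a :: finite_field alg_closure set.
           subfield K ring_of_type_algebra \<and> range to_ac \<subseteq> K \<and> card K = CARD('a) ^ m"
proof (rule ex1I)
  let ?Q = "CARD('a) ^ m"
  let ?K = "{x :: 'a alg_closure. x ^ ?Q = x}"
  have Q: "?Q > 0" by (simp add: finite_UNIV_card_ge_0)
  have fin: "finite ?K" using card_fixed_points[OF assms, where 'a = 'a] Q by (intro card_ge_0_finite) simp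
  have add: "x + y \<in> ?K" if "x \<in> ?K" "y \<in> ?K" for x y
    using that by (simp add: power_card_power_add)
  have diff: "x - y \<in> ?K" if "x \<in> ?K" "y \<in> ?K" for x y
    using power_card_power_add[of "x - y" y m] that by (simp add: eq_diff_eq)
  have "subfield ?K ring_of_type_algebra"
    unfolding subfield_type_iff
    using diff by (auto simp: power_mult_distrib power_inverse)
  moreover have "range to_ac \<subseteq> ?K"
    using finite_field_power_card_power_eq_same[where 'a = 'a, OF refl]
    by (auto simp flip: to_ac_power)
  ultimately show "subfield ?K ring_of_type_algebra \<and> range to_ac \<subseteq> ?K \<and> card ?K = ?Q"
    using card_fixed_points[OF assms, where 'a = 'a] by blast
  fix K :: "'a alg_closure set"
  assume K: "subfield K ring_of_type_algebra \<and> range to_ac \<subseteq> K \<and> card K = ?Q"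
  have "finite K" using K Q by (intro card_ge_0_finite) simp
  hence "K \<subseteq> ?K" using subfield_power_card[of K] K by auto
  thus "K = ?K"
    by (rule card_subset_eq[OF fin]) (simp add: K card_fixed_points[OF assms])
qed

lemma ext_field:
  assumes "m > 0"
  shows "subfield (ext_field m :: 'a :: finite_field alg_closure set) ring_of_type_algebra"
    and "range to_ac \<subseteq> (ext_field m :: 'a alg_closure set)"
    and "card (ext_field m :: 'a alg_closure set) = CARD('a) ^ m"
  using theI'[OF ex1_ext_field[OF assms, where 'a = 'a]] by (auto simp: ext_field_def)

end

theory Submission
  imports Defs
begin

text \<open>
  Write \<open>K\<close> for the field with \<open>q ^ m\<close> elements, \<open>m > 1\<close>, and look for a collision
  \<open>u (s + t) = u (s - t)\<close> with \<open>t \<noteq> 0\<close>. Taking \<open>p\<close>-th roots turns this into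
  \<open>2 * (t * s ^ q + (t ^ q - 2 * t) * s) = c\<close> with \<open>c ^ p = -2 * t\<close>, whose left-hand side is
  additive in \<open>s\<close>. It is solvable as soon as the additive map is injective on \<open>K\<close>, that is, unless
  \<open>2 - t ^ (q - 1)\<close> is a nonzero \<open>(q - 1)\<close>-st power, which would force it to have norm 1 over the
  field with \<open>q\<close> elements. The powers \<open>w = t ^ (q - 1)\<close> are the \<open>n = 1 + q + \<dots> + q ^ (m - 1)\<close>
  elements of norm \<open>w ^ n = 1\<close>. If \<open>2 - w\<close> had norm 1 for all of them, then
  \<open>(2 - w) ^ n - 1 = (-1) ^ n * (w ^ n - 1)\<close> as polynomials in \<open>w\<close>, and the derivatives at 0 differ
  because \<open>n \<equiv> 1\<close> modulo \<open>p\<close>.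
\<close>

lemma ex_norm_two_minus_power_neq_1:
  fixes S :: "'b :: field set"
  assumes n: "of_nat n = (1 :: 'b)" "n > 1" and two: "(2 :: 'b) \<noteq> 0" and d: "d > 0"
    and S: "card S = n * d" "\<And>t. t \<in> S \<Longrightarrow> t ^ (n * d) = 1"
  shows "\<exists>t\<in>S. (2 - t ^ d) ^ n \<noteq> 1"
proof (rule ccontr)
  assume "\<not> ?thesis"
  hence norm: "(2 - t ^ d) ^ n = 1" if "t \<in> S" for t using that by blast
  \<comment> \<open>The multiple of \<open>T ^ n - 1\<close> is chosen to cancel the leading term of
    \<open>(2 - T) ^ n\<close>, so \<open>P\<close> has degree below \<open>n\<close>. Under the
    assumption \<open>norm\<close>, it vanishes at every \<open>t ^ d\<close>.\<close>
  define P :: "'b poly" where "P = [:2, -1:] ^ n - 1 - smult ((-1) ^ n) (monom 1 n - 1)"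
  have "degree P \<le> n" unfolding P_def
    by (intro degree_diff_le order.trans[OF degree_smult_le]) (auto simp: degree_monom_eq)
  moreover have "coeff P n = 0"
  proof -
    have "coeff ([:2, -1:] ^ n :: 'b poly) n = lead_coeff ([:2, -1:] ^ n)" by simp
    also have "\<dots> = (-1) ^ n" by (simp only: lead_coeff_power) simp
    finally show ?thesis using n by (simp add: P_def coeff_1)
  qed
  ultimately have deg: "degree P < n"
    using n(2) by (cases "P = 0") (auto simp: le_less)
  \<comment> \<open>Substituting \<open>T ^ d\<close> allows the roots to be counted on
    \<open>S\<close> itself, whose size \<open>n * d\<close> exceeds the degree; the distinct
    \<open>d\<close>-th powers never have to be counted.\<close>
  have "pcompose P (monom 1 d) = 0"
  proof (rule poly_eqI_degree[where A = S])
    show "poly (pcompose P (monom 1 d)) t = poly 0 t" if "t \<in> S" for t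
    proof -
      have "(t ^ d) ^ n = 1" using S(2)[OF that] by (simp add: mult.commute flip: power_mult)
      thus ?thesis using norm[OF that] by (simp add: P_def poly_pcompose poly_monom)
    qed
    show "degree (pcompose P (monom 1 d)) < card S"
      using deg d by (simp add: degree_pcompose degree_monom_eq S)
    show "degree (0 :: 'b poly) < card S" using n d by (simp add: S)
  qed
  hence "P = 0" using d by (subst (asm) pcompose_eq_0_iff) (auto simp: degree_monom_eq)
  hence "poly (pderiv P) 0 = 0" by simp
  \<comment> \<open>The derivative of the monomial vanishes at 0 since \<open>n > 1\<close>, and the
    factor \<open>n\<close> coming from \<open>(2 - T) ^ n\<close> is 1 in the field.\<close>
  moreover have "poly (pderiv P) 0 = - (2 ^ (n - 1))"
    using n by (simp add: P_def pderiv_diff pderiv_smult pderiv_power pderiv_monom pderiv_pCons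
                  poly_monom)
  ultimately show False using two by simp
qed

context
  fixes m :: nat
  assumes m: "m > 0"
begin

lemma ext_field_closed:
  fixes x y :: "'a :: finite_field alg_closure"
  assumes x: "x \<in> ext_field m"
  shows "y \<in> ext_field m \<Longrightarrow> x - y \<in> ext_field m"
    and "y \<in> ext_field m \<Longrightarrow> x + y \<in> ext_field m"
    and "y \<in> ext_field m \<Longrightarrow> x * y \<in> ext_field m"
    and "inverse x \<in> ext_field m"
    and "- x \<in> ext_field m"
    and "x ^ i \<in> ext_field m"
proof -
  note R = ext_field(1)[OF m, where 'a = 'a, unfolded subfield_type_iff]
  have zero: "0 \<in> (ext_field m :: 'a alg_closure set)" using R by (metis diff_self)
  have minus: "- z \<in> ext_field m" if "z \<in> ext_field m" for z :: "'a alg_closure"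
    using R zero that by (metis diff_0)
  show "- x \<in> ext_field m" by (rule minus[OF x])
  show "x + y \<in> ext_field m" if "y \<in> ext_field m"
    using R minus[OF that] x by (metis diff_minus_eq_add)
  show "x ^ i \<in> ext_field m" by (induction i) (use R x in auto)
qed (use ext_field(1)[OF m, where 'a = 'a, unfolded subfield_type_iff] x in auto)

lemma zero_in_ext_field: "(0 :: 'a :: finite_field alg_closure) \<in> ext_field m"
  by (rule subsetD[OF ext_field(2)[OF m]], rule range_eqI, rule to_ac_0[symmetric])

lemma finite_ext_field: "finite (ext_field m :: 'a :: finite_field alg_closure set)"
  using ext_field(3)[OF m, where 'a = 'a] by (intro card_ge_0_finite) (simp add: finite_UNIV_card_ge_0)

lemma ext_field_power_eq:
  fixes x :: "'a :: finite_field alg_closure"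
  assumes "x \<in> ext_field m"
  shows "x ^ (CARD('a) ^ m) = x"
  using subfield_power_card[OF ext_field(1)[OF m] finite_ext_field assms] ext_field(3)[OF m] by metis

end

lemma of_nat_card_alg_closure: "of_nat CARD('a) = (0 :: 'a :: finite_field alg_closure)"
proof -
  \<comment> \<open>Translation by 1 permutes the field, so the two sums agree, although termwise
    they differ by 1 once for each element.\<close>
  have "(\<Sum>x\<in>UNIV. x :: 'a) = (\<Sum>x\<in>UNIV. x + 1)"
    by (rule sum.reindex_bij_witness[of _ "\<lambda>x. x + 1" "\<lambda>x. x - 1"]) auto
  hence "of_nat CARD('a) = (0 :: 'a)" by (simp add: sum.distrib)
  thus ?thesis by (metis to_ac_0 to_ac_of_nat)
qed

lemma two_neq_0_alg_closure:
  assumes "odd CARD('a)"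
  shows "(2 :: 'a :: finite_field alg_closure) \<noteq> 0"
proof
  assume "(2 :: 'a alg_closure) = 0"
  moreover obtain j where "CARD('a) = 2 * j + 1" using assms by (elim oddE)
  ultimately have "of_nat CARD('a) = (1 :: 'a alg_closure)" by simp
  thus False by (simp add: of_nat_card_alg_closure)
qed

lemma ex_injective_linearization:
  assumes odd: "odd CARD('a)" and m: "m > 1"
  shows "\<exists>t\<in>ext_field m. t \<noteq> 0 \<and>
    (\<forall>s\<in>ext_field m. t * s ^ CARD('a) + (t ^ CARD('a) - 2 * t) * s = 0 \<longrightarrow>
       s = (0 :: 'a :: finite_field alg_closure))"
proof -
  let ?q = "CARD('a)"
  define d where "d = ?q - 1"
  define n where "n = (\<Sum>i<m. ?q ^ i)"
  have "?q > 1" using card_mono[of UNIV "{0, 1 :: 'a}"] by simp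
  hence d: "d > 0" and q: "?q = Suc d" by (simp_all add: d_def)
  have m0: "m > 0" using m by simp
  have nd: "n * d + 1 = ?q ^ m"
  proof -
    have "int ?q ^ m - 1 = int d * int n"
      by (subst power_diff_1_eq) (simp add: q n_def)
    hence "int (n * d + 1) = int (?q ^ m)" by (simp add: algebra_simps)
    thus ?thesis by (simp only: of_nat_eq_iff)
  qed
  have n1: "of_nat n = (1 :: 'a alg_closure)"
  proof -
    \<comment> \<open>Since \<open>q\<close> is 0 in the field, only the term \<open>i = 0\<close>
      survives, through \<open>0 ^ 0 = 1\<close>.\<close>
    have "of_nat n = (\<Sum>i<m. (0 :: 'a alg_closure) ^ i)"
      by (simp add: n_def of_nat_card_alg_closure)
    also have "\<dots> = 1" using m0 by (cases m) (simp_all add: sum.lessThan_Suc_shift del: sum.lessThan_Suc)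
    finally show ?thesis .
  qed
  have "n > 1"
  proof -
    have "(\<Sum>i<2. ?q ^ i) \<le> n" unfolding n_def using m by (intro sum_mono2) auto
    thus ?thesis using q by (simp add: numeral_2_eq_2)
  qed
  have pow1: "x ^ (n * d) = 1" if "x \<in> ext_field m" "x \<noteq> 0" for x :: "'a alg_closure"
    using ext_field_power_eq[OF m0 that(1)] that(2) by (simp flip: nd)
  have "card (ext_field m - {0 :: 'a alg_closure}) = n * d"
    using ext_field(3)[OF m0, where 'a = 'a] nd zero_in_ext_field[OF m0, where 'a = 'a] by simp
  then obtain t :: "'a alg_closure" where t: "t \<in> ext_field m" "t \<noteq> 0" "(2 - t ^ d) ^ n \<noteq> 1"
    using ex_norm_two_minus_power_neq_1[OF n1 \<open>n > 1\<close> two_neq_0_alg_closure[OF odd] d,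
        of "ext_field m - {0}"] pow1 by blast
  have "s = 0" if s: "s \<in> ext_field m" "t * s ^ ?q + (t ^ ?q - 2 * t) * s = 0" for s
  proof (rule ccontr)
    assume "s \<noteq> 0"
    \<comment> \<open>As \<open>q = d + 1\<close>, the additive map factors; a nonzero root
      \<open>s\<close> thus makes \<open>2 - t ^ d\<close> the \<open>d\<close>-th power of
      \<open>s\<close>, contradicting the choice of \<open>t\<close>.\<close>
    have "t * s * (s ^ d + t ^ d - 2) = 0" using s(2) by (simp add: q algebra_simps)
    hence "s ^ d + t ^ d - 2 = 0" using \<open>s \<noteq> 0\<close> t(2) by simp
    hence "2 - t ^ d = s ^ d" by (simp add: diff_eq_eq add.commute)
    hence "(2 - t ^ d) ^ n = s ^ (n * d)" by (simp add: mult.commute flip: power_mult)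
    with pow1[OF s(1) \<open>s \<noteq> 0\<close>] t(3) show False by simp
  qed
  thus ?thesis using t by blast
qed

lemma map_poly_to_ac_mult:
  "map_poly to_ac (f * g) = map_poly to_ac f * map_poly to_ac g"
  by (intro poly_eqI) (simp add: coeff_map_poly coeff_mult to_ac_sum)

lemma map_poly_to_ac_power: "map_poly to_ac (f ^ n) = map_poly to_ac f ^ n"
  by (induction n) (simp_all add: map_poly_to_ac_mult)

text \<open>The two occurrences of \<open>u_poly\<close> have different coefficient types. The
  formula involves only the constants 0 and 1, so it survives the base change to the
  closure.\<close>

lemma map_poly_to_ac_u_poly: "map_poly to_ac (u_poly p q) = u_poly p q"
proof -
  have add: "map_poly to_ac (f + g) = map_poly to_ac f + map_poly to_ac g"
    and diff: "map_poly to_ac (f - g) = map_poly to_ac f - map_poly to_ac g" for f g :: "'a poly"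
    by (intro poly_eqI; simp add: coeff_map_poly)+
  show ?thesis
    by (simp add: u_poly_def Let_def add diff map_poly_to_ac_mult map_poly_to_ac_power map_poly_pCons)
qed

lemma poly_u_poly: "poly (u_poly p q) x = x + (x * (x ^ q - x)) ^ p"
  by (simp add: u_poly_def Let_def)

lemma CHAR_eq_if_card_eq_prime_power:
  assumes "prime p" "CARD('a) = p ^ k"
  shows "CHAR('a :: finite_field alg_closure) = p"
proof -
  have "CHAR('a alg_closure) dvd p ^ k"
    using of_nat_card_alg_closure[where 'a = 'a] assms(2) by (simp only: of_nat_eq_0_iff_char_dvd)
  moreover have "prime CHAR('a alg_closure)" by simp
  ultimately show ?thesis using assms(1) prime_dvd_power primes_dvd_imp_eq by blast
qed

lemma not_inj_on_u_poly:
  assumes p: "prime p" "k > 0" "CARD('a :: finite_field) = p ^ k" and odd: "odd CARD('a)" and m: "m > 1"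
  shows "\<not> inj_on (poly (u_poly p CARD('a))) (ext_field m :: 'a alg_closure set)"
proof
  let ?q = "CARD('a)" and ?K = "ext_field m :: 'a alg_closure set"
  let ?u = "poly (u_poly p ?q) :: 'a alg_closure \<Rightarrow> _"
  assume inj: "inj_on ?u ?K"
  have m0: "m > 0" using m by simp
  note closed = ext_field_closed[OF m0]
  have two: "(2 :: 'a alg_closure) \<noteq> 0" by (rule two_neq_0_alg_closure[OF odd])
  have two_K: "(2 :: 'a alg_closure) \<in> ?K"
    by (rule subsetD[OF ext_field(2)[OF m0]], rule range_eqI, rule to_ac_numeral[symmetric])
  have add_q: "(x + y) ^ ?q = x ^ ?q + y ^ ?q" for x y :: "'a alg_closure"
    by (rule power_card_add)
  have diff_q: "(x - y) ^ ?q = x ^ ?q - y ^ ?q" for x y :: "'a alg_closure"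
    using add_q[of "x - y" y] by (simp add: algebra_simps)
  have add_p: "(x + y) ^ p = x ^ p + y ^ p" for x y :: "'a alg_closure"
    using CHAR_eq_if_card_eq_prime_power[OF p(1,3)] p(1) by (intro freshmans_dream) auto
  have diff_p: "(x - y) ^ p = x ^ p - y ^ p" for x y :: "'a alg_closure"
    using add_p[of "x - y" y] by (simp add: algebra_simps)
  obtain t where t: "t \<in> ?K" "t \<noteq> 0"
    and ker: "\<And>s. s \<in> ?K \<Longrightarrow> t * s ^ ?q + (t ^ ?q - 2 * t) * s = 0 \<Longrightarrow> s = 0"
    using ex_injective_linearization[OF odd m] by auto
  define L where "L = (\<lambda>s. t * s ^ ?q + (t ^ ?q - 2 * t) * s)"
  have "inj_on L ?K"
  proof (rule inj_onI)
    fix x y assume xy: "x \<in> ?K" "y \<in> ?K" "L x = L y"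
    have "L (x - y) = L x - L y" by (simp add: L_def diff_q algebra_simps)
    hence "x - y = 0" using xy ker[OF closed(1)[OF xy(1,2)]] by (simp add: L_def)
    thus "x = y" by simp
  qed
  moreover have "L ` ?K \<subseteq> ?K"
    using t two_K by (auto simp: L_def intro!: closed)
  ultimately have surj: "L ` ?K = ?K"
    by (intro endo_inj_surj finite_ext_field[OF m0])
  \<comment> \<open>On the field with \<open>q ^ m = p ^ (k * m)\<close> elements, raising to the
    power \<open>p ^ (k * m - 1)\<close> inverts the \<open>p\<close>-th power map.\<close>
  define c where "c = (- 2 * t) ^ (p ^ (k * m - 1))"
  have c: "c ^ p = - 2 * t"
  proof -
    have "k * m = Suc (k * m - 1)" using p(2) m0 by simp
    hence "p ^ (k * m - 1) * p = ?q ^ m"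
      using p(3) by (metis power_Suc2 power_mult)
    hence "c ^ p = (- 2 * t) ^ (?q ^ m)" by (simp only: c_def flip: power_mult)
    also have "\<dots> = - 2 * t" using t two_K by (intro ext_field_power_eq[OF m0] closed)
    finally show ?thesis .
  qed
  have "c / 2 \<in> ?K"
    unfolding c_def divide_inverse using t two_K by (intro closed)
  then obtain s where s: "s \<in> ?K" "L s = c / 2" using surj by (metis imageE)
  define w where "w = (\<lambda>x :: 'a alg_closure. x * (x ^ ?q - x))"
  \<comment> \<open>\<open>w\<close> is an even quadratic map with polar form
    \<open>w (s + t) - w s - w t = L s\<close>: the terms in \<open>s\<close> alone and in
    \<open>t\<close> alone cancel, and the mixed ones double.\<close>
  have "w (s + t) - w (s - t) = 2 * L s"
    by (simp add: w_def add_q diff_q L_def algebra_simps)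
  also have "\<dots> = c" using s(2) two by (simp add: mult.commute)
  \<comment> \<open>The value \<open>- 2 * t\<close> exactly offsets the difference of the linear
    parts, \<open>(s + t) - (s - t)\<close>.\<close>
  finally have "w (s + t) ^ p - w (s - t) ^ p = - 2 * t"
    by (simp only: c flip: diff_p)
  hence "s + t + w (s + t) ^ p = s - t + w (s - t) ^ p" by (simp add: algebra_simps)
  hence "?u (s + t) = ?u (s - t)" by (simp only: poly_u_poly w_def)
  hence "s + t = s - t" using inj_onD[OF inj] closed(1,2)[OF s(1) t(1)] by blast
  hence "2 * t = 0" by (metis add_diff_cancel_left' diff_add_eq mult_2 eq_iff_diff_eq_0 diff_diff_eq2)
  thus False using two t by simp
qed

theorem theorem6p2:
  fixes p q k :: nat and u :: "'a :: finite_field poly"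
  assumes "prime p" and "k > 0" and "q = p ^ k" and "odd q"
    and "CARD('a) = q"
    and "u = u_poly p q"
  shows "ext_perm_spectrum u = {1} \<and>
         (\<forall>x. poly u x = x) \<and>
         (\<forall>m>1. \<not> inj_on (poly (map_poly to_ac u)) (ext_field m))"
proof -
  have p: "p > 0" using assms(1) prime_gt_0_nat by blast
  have u: "map_poly to_ac u = u_poly p q" using assms(6) map_poly_to_ac_u_poly by simp
  have fix_base: "poly u x = x" for x
    using finite_field_power_card_eq_same[of x] p by (simp add: assms(5,6) poly_u_poly)
  have not_inj: "\<not> inj_on (poly (map_poly to_ac u)) (ext_field m)" if "m > 1" for m
    using not_inj_on_u_poly[of p k m, where 'a = 'a] assms that u by simp
  \<comment> \<open>Here \<open>x ^ q = x\<close>, so the correction term is \<open>0 ^ p\<close>,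
    which is 0 because \<open>p > 0\<close>.\<close>
  have "poly (map_poly to_ac u) x = x" if "x \<in> ext_field 1" for x
    using ext_field_power_eq[of 1 x] that p by (simp add: assms(5) u poly_u_poly)
  hence "bij_betw (poly (map_poly to_ac u)) (ext_field 1) (ext_field 1)"
    by (subst bij_betw_cong[where g = id]) auto
  \<comment> \<open>The definition of the spectrum excludes \<open>m = 0\<close>, where
    \<open>ext_field\<close> is unspecified.\<close>
  moreover have "m = 1" if "m \<in> ext_perm_spectrum u" for m
    using that not_inj[of m] unfolding ext_perm_spectrum_def bij_betw_def
    by (cases "m > 1") auto
  ultimately have "ext_perm_spectrum u = {1}"
    unfolding ext_perm_spectrum_def by (intro equalityI subsetI) auto
  thus ?thesis using fix_base not_inj by blast
qed

end
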